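(* Let $\lambda\in\mathbb{R}$, let $r\ge 0$ be an integer, and let $(a_{n,\lambda})_{n\ge 0}$ and $(b_{n,\lambda})_{n\ge 0}$ be sequences of complex numbers. Then $$a_{n,\lambda}=\sum_{k=0}^{n}(-1)^{n-k}{n+r \brack k+r}_{r,\lambda}b_{k,\lambda}\quad\text{for all } n\ge 0$$ if and only if $$b_{n,\lambda}=\sum_{k=0}^{n}{n+r \brace k+r}_{r,\lambda}a_{k,\lambda}\quad\text{for all } n\ge 0.$$
   Context: For $\lambda\in\mathbb{R}$ put $(x)_{0,\lambda}=1$, $(x)_{n,\lambda}=x(x-\lambda)\cdots(x-(n-1)\lambda)$ and $\langle x\rangle_{0,\lambda}=1$, $\langle x\rangle_{n,\lambda}=x(x+\lambda)\cdots(x+(n-1)\lambda)$ for $n\ge 1$. Also $(x)_0=\langle x\rangle_0=1$, $(x)_n=x(x-1)\cdots(x-n+1)$ and $\langle x\rangle_n=x(x+1)\cdots(x+n-1)$ for $n\ge1$. For an integer $r\ge 0$, the unsigned degenerate $r$-Stirling numbers of the first kind ${n+r \brack k+r}_{r,\lambda}$ ($0\le k\le n$) are defined by the polynomial identity in $x$: $\langle x+r\rangle_{n}=\sum_{k=0}^{n}{n+r \brack k+r}_{r,\lambda}\langle x\rangle_{k,\lambda}$ for $n\ge 0$. The degenerate $r$-Stirling numbers of the second kind ${n+r \brace k+r}_{r,\lambda}$ ($0\le k\le n$) are defined by the polynomial identity in $x$: $(x+r)_{n,\lambda}=\sum_{k=0}^{n}{n+r \brace k+r}_{r,\lambda}(x)_{k}$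 for $n\ge 0$. *)

theory Defs
  imports Complex_Main "HOL-Computational_Algebra.Polynomial"
begin

definition deg_falling :: "real \<Rightarrow> real \<Rightarrow> nat \<Rightarrow> real" where
  "deg_falling l x n = (\<Prod>i<n. x - real i * l)"

definition deg_rising :: "real \<Rightarrow> real \<Rightarrow> nat \<Rightarrow> real" where
  "deg_rising l x n = (\<Prod>i<n. x + real i * l)"

abbreviation falling :: "real \<Rightarrow> nat \<Rightarrow> real" where
  "falling x n \<equiv> deg_falling 1 x n"

text \<open>
  The ordinary rising factorial is \<open>pochhammer\<close>. Both families of Stirling numbers below are
  indexed by the unshifted \<open>n\<close> and \<open>k\<close>: \<open>deg_r_stirling1 l r n k\<close> is the number with upper
  index \<open>n + r\<close> and lower index \<open>k + r\<close>, and likewise for \<open>deg_r_stirling2\<close>. They are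
  extended by zero to \<open>k > n\<close>, which makes the coefficient sequence unique. A polynomial
  identity over the reals is stated as equality of values at every real point.
\<close>

definition deg_r_stirling1 :: "real \<Rightarrow> nat \<Rightarrow> nat \<Rightarrow> nat \<Rightarrow> real" where
  "deg_r_stirling1 l r n = (THE c. (\<forall>k>n. c k = 0) \<and>
     (\<forall>x::real. pochhammer (x + real r) n = (\<Sum>k=0..n. c k * deg_rising l x k)))"

definition deg_r_stirling2 :: "real \<Rightarrow> nat \<Rightarrow> nat \<Rightarrow> nat \<Rightarrow> real" where
  "deg_r_stirling2 l r n = (THE c. (\<forall>k>n. c k = 0) \<and>
     (\<forall>x::real. deg_falling l (x + real r) n = (\<Sum>k=0..n. c k * falling x k)))"

text \<open>Existence and uniqueness of the coefficients, so that the descriptions above denote.\<close>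

lemma degree_prod_linear:
  fixes f :: "nat \<Rightarrow> real"
  shows "degree (\<Prod>i<n. [:f i, 1:]) = n" "(\<Prod>i<n. [:f i, 1:]) \<noteq> 0"
proof -
  show nz: "(\<Prod>i<n. [:f i, 1:]) \<noteq> 0"
    by simp
  show "degree (\<Prod>i<n. [:f i, 1:]) = n"
    by (subst degree_prod_eq_sum_degree) auto
qed

lemma graded_expansion_exists:
  fixes p :: "nat \<Rightarrow> real poly"
  assumes deg: "\<And>k. degree (p k) = k" and nz: "\<And>k. p k \<noteq> 0" and "degree q \<le> n"
  shows "\<exists>c. (\<forall>k>n. c k = 0) \<and> q = (\<Sum>k=0..n. smult (c k) (p k))"
  using assms(3)
proof (induction n arbitrary: q)
  case 0
  obtain u where u: "p 0 = [:u:]" using deg[of 0] by (metis degree_eq_zeroE)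
  obtain v where v: "q = [:v:]" using 0 by (metis degree_eq_zeroE le_zero_eq)
  have "u \<noteq> 0" using nz[of 0] u by auto
  then show ?case using u v by (intro exI[of _ "\<lambda>k. if k = 0 then v / u else 0"]) auto
next
  case (Suc n)
  let ?t = "coeff q (Suc n) / coeff (p (Suc n)) (Suc n)"
  let ?q = "q - smult ?t (p (Suc n))"
  have lc: "coeff (p (Suc n)) (Suc n) \<noteq> 0"
    using deg[of "Suc n"] nz[of "Suc n"] by (metis leading_coeff_0_iff)
  have "degree ?q \<le> n"
  proof (rule degree_le, intro allI impI)
    fix i assume "n < i"
    then consider "i = Suc n" | "i > Suc n" by linarith
    then show "coeff ?q i = 0"
    proof cases
      case 1
      then show ?thesis using lc by simp
    next
      case 2
      then show ?thesis using Suc.prems deg[of "Suc n"] by (simp add: coeff_eq_0)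
    qed
  qed
  from Suc.IH[OF this] obtain c
    where c: "\<forall>k>n. c k = 0" "?q = (\<Sum>k=0..n. smult (c k) (p k))" by blast
  have "(\<Sum>k=0..n. smult ((c(Suc n := ?t)) k) (p k)) = ?q"
    unfolding c(2) by (rule sum.cong) auto
  then have "q = (\<Sum>k=0..Suc n. smult ((c(Suc n := ?t)) k) (p k))"
    by (simp add: sum.atLeast0_atMost_Suc)
  moreover have "\<forall>k>Suc n. (c(Suc n := ?t)) k = 0" using c(1) by simp
  ultimately show ?case by blast
qed

lemma graded_expansion_zero:
  fixes p :: "nat \<Rightarrow> real poly"
  assumes deg: "\<And>k. degree (p k) = k" and nz: "\<And>k. p k \<noteq> 0"
    and "(\<Sum>k=0..n. smult (c k) (p k)) = 0" and "k \<le> n"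
  shows "c k = 0"
  using assms(3,4)
proof (induction n arbitrary: k)
  case 0
  then show ?case using nz[of 0] by simp
next
  case (Suc n)
  have "coeff (\<Sum>k=0..n. smult (c k) (p k)) (Suc n) = 0"
    by (simp add: coeff_sum coeff_eq_0 deg)
  then have "c (Suc n) * coeff (p (Suc n)) (Suc n) = 0"
    using arg_cong[OF Suc.prems(1), of "\<lambda>q. coeff q (Suc n)"]
    by (simp add: sum.atLeast0_atMost_Suc)
  moreover have "coeff (p (Suc n)) (Suc n) \<noteq> 0"
    using deg[of "Suc n"] nz[of "Suc n"] by (metis leading_coeff_0_iff)
  ultimately have top: "c (Suc n) = 0" by simp
  then have "(\<Sum>k=0..n. smult (c k) (p k)) = 0"
    using Suc.prems(1) by (simp add: sum.atLeast0_atMost_Suc)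
  then show ?case using Suc.IH Suc.prems(2) top by (metis le_Suc_eq)
qed

lemma graded_expansion_ex1:
  fixes p :: "nat \<Rightarrow> real poly"
  assumes deg: "\<And>k. degree (p k) = k" and nz: "\<And>k. p k \<noteq> 0" and "degree q \<le> n"
  shows "\<exists>!c. (\<forall>k>n. c k = 0) \<and> (\<forall>x. poly q x = (\<Sum>k=0..n. c k * poly (p k) x))"
proof -
  have iff: "(\<forall>x. poly q x = (\<Sum>k=0..n. c k * poly (p k) x)) \<longleftrightarrow>
      q = (\<Sum>k=0..n. smult (c k) (p k))" for c
    by (simp add: poly_eq_poly_eq_iff[symmetric] fun_eq_iff poly_sum)
  show ?thesis unfolding iff
  proof (rule ex_ex1I)
    show "\<exists>c. (\<forall>k>n. c k = 0) \<and> q = (\<Sum>k=0..n. smult (c k) (p k))"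
      using graded_expansion_exists[of p, OF deg nz assms(3)] by blast
  next
    fix c d
    assume c: "(\<forall>k>n. c k = 0) \<and> q = (\<Sum>k=0..n. smult (c k) (p k))"
      and d: "(\<forall>k>n. d k = 0) \<and> q = (\<Sum>k=0..n. smult (d k) (p k))"
    then have "(\<Sum>k=0..n. smult (c k - d k) (p k)) = 0"
      by (simp add: smult_diff_left sum_subtractf)
    then have "c k = d k" if "k \<le> n" for k
      using graded_expansion_zero[of p "\<lambda>k. c k - d k" n, OF deg nz] that by force
    then show "c = d" using c d by (metis ext linorder_not_le)
  qed
qed

lemma deg_rising_conv_poly: "deg_rising l x n = poly (\<Prod>i<n. [:real i * l, 1:]) x"
  by (simp add: deg_rising_def poly_prod algebra_simps)

lemma deg_falling_conv_poly: "deg_falling l x n = poly (\<Prod>i<n. [:- (real i * l), 1:]) x"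
  by (simp add: deg_falling_def poly_prod algebra_simps)

lemma deg_r_stirling1_ex1:
  "\<exists>!c. (\<forall>k>n. c k = 0) \<and>
     (\<forall>x::real. pochhammer (x + real r) n = (\<Sum>k=0..n. c k * deg_rising l x k))"
proof -
  have q: "pochhammer (x + real r) n = poly (\<Prod>i<n. [:real r + real i, 1:]) x" for x
    by (simp add: pochhammer_prod poly_prod algebra_simps lessThan_atLeast0)
  show ?thesis
    unfolding q deg_rising_conv_poly
    by (rule graded_expansion_ex1) (use degree_prod_linear in auto)
qed

lemma deg_r_stirling2_ex1:
  "\<exists>!c. (\<forall>k>n. c k = 0) \<and>
     (\<forall>x::real. deg_falling l (x + real r) n = (\<Sum>k=0..n. c k * falling x k))"
proof -
  have q: "deg_falling l (x + real r) n = poly (\<Prod>i<n. [:real r - real i * l, 1:]) x" for x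
    by (simp add: deg_falling_def poly_prod algebra_simps)
  show ?thesis
    unfolding q deg_falling_conv_poly[of 1]
    by (rule graded_expansion_ex1) (use degree_prod_linear in auto)
qed

lemma deg_r_stirling1_gt: "k > n \<Longrightarrow> deg_r_stirling1 l r n k = 0"
  and pochhammer_deg_r_stirling1:
    "pochhammer (x + real r) n = (\<Sum>k=0..n. deg_r_stirling1 l r n k * deg_rising l x k)"
  using theI'[OF deg_r_stirling1_ex1[of n r l], folded deg_r_stirling1_def] by blast+

lemma deg_r_stirling2_gt: "k > n \<Longrightarrow> deg_r_stirling2 l r n k = 0"
  and deg_falling_deg_r_stirling2:
    "deg_falling l (x + real r) n = (\<Sum>k=0..n. deg_r_stirling2 l r n k * falling x k)"
  using theI'[OF deg_r_stirling2_ex1[of n l r], folded deg_r_stirling2_def] by blast+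

end

theory Submission
  imports Defs
begin

text \<open>
  Both families of numbers are change-of-basis matrices between the same two graded bases of
  the real polynomials, \<open>(x)\<^sub>n\<close> and \<open>(x + r)\<^bsub>n,\<lambda>\<^esub>\<close>. For the second kind this is the definition.
  For the first kind, replace \<open>x\<close> by \<open>- x - r\<close> in \<open>\<langle>x + r\<rangle>\<^sub>n = (\<Sum>k\<le>n. c\<^sub>n\<^sub>k \<langle>x\<rangle>\<^bsub>k,\<lambda>\<^esub>)\<close>: a rising
  factorial at \<open>- y\<close> is, up to the sign \<open>(-1)\<^sup>n\<close>, the falling factorial at \<open>y\<close>, so the identity
  becomes \<open>(x)\<^sub>n = (\<Sum>k\<le>n. (-1)\<^bsup>n - k\<^esup> c\<^sub>n\<^sub>k (x + r)\<^bsub>k,\<lambda>\<^esub>)\<close>. Coordinates in a basis are unique, so the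
  signed first-kind matrix and the second-kind matrix are inverse to each other
  (\<open>graded_change_of_basis_inverse\<close>), and the theorem says that two inverse lower triangular
  matrices act inversely on sequences (\<open>triangular_inversion\<close>).
\<close>

text \<open>
  Substituting one expansion into the other expresses each \<open>q n\<close> in the basis \<open>q\<close> itself, with
  the entries of the matrix product \<open>B A\<close> as coordinates; these can only be the trivial ones.
\<close>

lemma graded_change_of_basis_inverse:
  fixes p q :: "nat \<Rightarrow> real poly" and A B :: "nat \<Rightarrow> nat \<Rightarrow> real"
  assumes deg: "\<And>k. degree (q k) = k" and nz: "\<And>k. q k \<noteq> 0"
    and A0: "\<And>n k. n < k \<Longrightarrow> A n k = 0"
    and p: "\<And>n. p n = (\<Sum>k=0..n. smult (A n k) (q k))"
    and q: "\<And>n. q n = (\<Sum>k=0..n. smult (B n k) (p k))"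
    and "k \<le> n"
  shows "(\<Sum>j=0..n. B n j * A j k) = (if k = n then 1 else 0)"
proof -
  let ?C = "\<lambda>k. \<Sum>j=0..n. B n j * A j k"
  \<comment> \<open>Padding with the zero entries above the diagonal makes the range of the inner sum independent
    of \<open>j\<close>, so that the double sum below can be interchanged.\<close>
  have p': "p j = (\<Sum>k=0..n. smult (A j k) (q k))" if "j \<le> n" for j
    unfolding p[of j] using that by (intro sum.mono_neutral_left) (auto simp: A0)
  have "q n = (\<Sum>j=0..n. \<Sum>k=0..n. smult (B n j * A j k) (q k))"
    unfolding q[of n]
    by (intro sum.cong refl) (simp add: p' poly_eq_iff coeff_sum sum_distrib_left mult.assoc)
  also have "\<dots> = (\<Sum>k=0..n. smult (?C k) (q k))"
    by (subst sum.swap) (simp add: poly_eq_iff coeff_sum sum_distrib_right)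
  finally have C: "q n = (\<Sum>k=0..n. smult (?C k) (q k))" .
  have "(\<Sum>k=0..n. smult (if k = n then 1 else 0) (q k)) = (\<Sum>k=0..n. if k = n then q k else 0)"
    by (rule sum.cong) auto
  also have "\<dots> = q n"
    by simp
  finally have "(\<Sum>k=0..n. smult (?C k - (if k = n then 1 else 0)) (q k)) = 0"
    using C by (simp add: smult_diff_left sum_subtractf)
  from graded_expansion_zero[of q, OF deg nz this \<open>k \<le> n\<close>] show ?thesis
    by simp
qed

text \<open>
  Since \<open>A\<close> is lower triangular, each \<open>a n\<close> is a finite sum, and applying \<open>B\<close> to \<open>a = A b\<close> gives
  \<open>(B A) b = b\<close>. Only one implication is concluded; exchanging the roles of \<open>A\<close> and \<open>B\<close> gives
  its converse, from the product \<open>A B\<close>.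
\<close>

lemma triangular_inversion:
  fixes A B :: "nat \<Rightarrow> nat \<Rightarrow> 'a::comm_ring_1"
  assumes A0: "\<And>n k. n < k \<Longrightarrow> A n k = 0"
    and BA: "\<And>n k. k \<le> n \<Longrightarrow> (\<Sum>j=0..n. B n j * A j k) = (if k = n then 1 else 0)"
    and a: "\<And>n. a n = (\<Sum>k=0..n. A n k * b k)"
  shows "b n = (\<Sum>k=0..n. B n k * a k)"
proof -
  have a': "a j = (\<Sum>k=0..n. A j k * b k)" if "j \<le> n" for j
    unfolding a[of j] using that by (intro sum.mono_neutral_left) (auto simp: A0)
  have "(\<Sum>j=0..n. B n j * a j) = (\<Sum>j=0..n. \<Sum>k=0..n. B n j * A j k * b k)"
    by (intro sum.cong refl) (simp add: a' sum_distrib_left mult.assoc)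
  also have "\<dots> = (\<Sum>k=0..n. (\<Sum>j=0..n. B n j * A j k) * b k)"
    by (subst sum.swap) (simp add: sum_distrib_right)
  also have "\<dots> = (\<Sum>k=0..n. if k = n then b k else 0)"
    by (intro sum.cong refl) (simp add: BA)
  finally show ?thesis by simp
qed

lemma deg_rising_minus: "deg_rising l (- x) n = (- 1) ^ n * deg_falling l x n"
proof -
  have "deg_rising l (- x) n = (\<Prod>i<n. (- 1) * (x - real i * l))"
    by (simp add: deg_rising_def algebra_simps)
  also have "\<dots> = (- 1) ^ n * deg_falling l x n"
    unfolding prod.distrib by (simp add: deg_falling_def)
  finally show ?thesis .
qed

lemma pochhammer_conv_deg_rising: "pochhammer x n = deg_rising 1 x n"
  by (simp add: pochhammer_prod deg_rising_def lessThan_atLeast0)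

text \<open>
  The defining expansion of the first kind, read at the point \<open>- x - r\<close>. This is where the sign
  \<open>(-1)\<^bsup>n - k\<^esup>\<close> of the theorem comes from, and it moves the shift by \<open>r\<close> from the ordinary to the
  degenerate factorial, where the second kind has it.
\<close>

lemma falling_signed_deg_r_stirling1:
  "falling x n =
     (\<Sum>k=0..n. (- 1) ^ (n - k) * deg_r_stirling1 l r n k * deg_falling l (x + real r) k)"
proof -
  have "(- 1) ^ n * falling x n = pochhammer (- (x + real r) + real r) n"
    by (simp add: pochhammer_conv_deg_rising deg_rising_minus)
  also have "\<dots> = (\<Sum>k=0..n. deg_r_stirling1 l r n k * ((- 1) ^ k * deg_falling l (x + real r) k))"
    unfolding pochhammer_deg_r_stirling1[of _ r n l] deg_rising_minus ..
  finally have "(- 1) ^ n * ((- 1) ^ n * falling x n) =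
      (\<Sum>k=0..n. (- 1) ^ n * (- 1) ^ k * deg_r_stirling1 l r n k * deg_falling l (x + real r) k)"
    by (simp add: sum_distrib_left mult_ac)
  moreover have "(- 1) ^ n * (- 1) ^ k = ((- 1) ^ (n - k) :: real)" if "k \<le> n" for k
    using that by (simp add: minus_one_power_iff)
  ultimately show ?thesis
    by (simp add: mult.assoc[symmetric] power_add[symmetric])
qed

text \<open>
  Pointwise identities over the reals lifted to polynomials, where degrees and coordinates make
  sense. The factor \<open>real i * 1\<close> keeps \<open>F\<close> syntactically the case \<open>l = 1\<close> of
  \<open>deg_falling_conv_poly\<close>.
\<close>

lemma stirling_expansions_as_polys:
  fixes l :: real and r :: nat
  defines "F \<equiv> \<lambda>n. \<Prod>i<n. [:- (real i * 1), 1:]"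
    and "G \<equiv> \<lambda>n. \<Prod>i<n. [:real r - real i * l, 1:]"
  shows "F n = (\<Sum>k=0..n. smult ((- 1) ^ (n - k) * deg_r_stirling1 l r n k) (G k))"
    and "G n = (\<Sum>k=0..n. smult (deg_r_stirling2 l r n k) (F k))"
proof -
  have F: "poly (F n) x = falling x n" for n x
    unfolding F_def deg_falling_conv_poly ..
  have G: "poly (G n) x = deg_falling l (x + real r) n" for n x
    by (simp add: G_def deg_falling_def poly_prod algebra_simps)
  show "F n = (\<Sum>k=0..n. smult ((- 1) ^ (n - k) * deg_r_stirling1 l r n k) (G k))"
    by (rule poly_ext) (simp only: poly_sum poly_smult F G falling_signed_deg_r_stirling1[of _ n l r])
  show "G n = (\<Sum>k=0..n. smult (deg_r_stirling2 l r n k) (F k))"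
    by (rule poly_ext) (simp only: poly_sum poly_smult F G deg_falling_deg_r_stirling2)
qed

lemma deg_r_stirling_orthogonality:
  assumes "k \<le> n"
  shows "(\<Sum>j=0..n. deg_r_stirling2 l r n j * ((- 1) ^ (j - k) * deg_r_stirling1 l r j k)) =
      (if k = n then 1 else 0)"
    and "(\<Sum>j=0..n. (- 1) ^ (n - j) * deg_r_stirling1 l r n j * deg_r_stirling2 l r j k) =
      (if k = n then 1 else 0)"
proof -
  let ?F = "\<lambda>n. \<Prod>i<n. [:- (real i * 1), 1:]"
  let ?G = "\<lambda>n. \<Prod>i<n. [:real r - real i * l, 1:]"
  let ?A = "\<lambda>n k. (- 1) ^ (n - k) * deg_r_stirling1 l r n k"
  let ?B = "\<lambda>n k. deg_r_stirling2 l r n k"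
  show "(\<Sum>j=0..n. ?B n j * ?A j k) = (if k = n then 1 else 0)"
    by (rule graded_change_of_basis_inverse[where p = ?F and q = ?G])
       (simp_all only: degree_prod_linear stirling_expansions_as_polys[symmetric]
          deg_r_stirling1_gt mult_zero_right assms not_False_eq_True)
  show "(\<Sum>j=0..n. ?A n j * ?B j k) = (if k = n then 1 else 0)"
    by (rule graded_change_of_basis_inverse[where p = ?G and q = ?F])
       (simp_all only: degree_prod_linear stirling_expansions_as_polys[symmetric]
          deg_r_stirling2_gt assms not_False_eq_True)
qed

theorem theorem2:
  fixes l :: real and r :: nat and a b :: "nat \<Rightarrow> complex"
  shows "(\<forall>n. a n = (\<Sum>k=0..n. (-1) ^ (n - k) * complex_of_real (deg_r_stirling1 l r n k) * b k))
    \<longleftrightarrow> (\<forall>n. b n = (\<Sum>k=0..n. complex_of_real (deg_r_stirling2 l r n k) * a k))"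
proof -
  let ?A = "\<lambda>n k. (-1) ^ (n - k) * complex_of_real (deg_r_stirling1 l r n k)"
  let ?B = "\<lambda>n k. complex_of_real (deg_r_stirling2 l r n k)"
  have BA: "(\<Sum>j=0..n. ?B n j * ?A j k) = (if k = n then 1 else 0)" if "k \<le> n" for n k
    using arg_cong[OF deg_r_stirling_orthogonality(1)[OF that, of l r], of complex_of_real]
    by simp
  have AB: "(\<Sum>j=0..n. ?A n j * ?B j k) = (if k = n then 1 else 0)" if "k \<le> n" for n k
    using arg_cong[OF deg_r_stirling_orthogonality(2)[OF that, of l r], of complex_of_real]
    by simp
  show ?thesis
  proof (intro iffI allI)
    fix n
    assume "\<forall>n. a n = (\<Sum>k=0..n. ?A n k * b k)"
    then show "b n = (\<Sum>k=0..n. ?B n k * a k)"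
      by (intro triangular_inversion[of ?A ?B, OF _ BA]) (simp_all add: deg_r_stirling1_gt)
  next
    fix n
    assume "\<forall>n. b n = (\<Sum>k=0..n. ?B n k * a k)"
    then show "a n = (\<Sum>k=0..n. ?A n k * b k)"
      by (intro triangular_inversion[of ?B ?A, OF _ AB]) (simp_all add: deg_r_stirling2_gt)
  qed
qed

end
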